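(* Let $q$ be a power of an odd prime $p$, let $L(x)$ be an $\mathbb{F}_q$-linearized polynomial, and let $C$ denote the curve $y^q-y=xL(x)$. Let $n\ge1$ and let $\ell$ be a prime with $\gcd(\ell,2p)=1$. If $\lambda_n(C)\neq 0$ and $\lambda_{n\ell}(C)\neq 0$, then $$\lambda_n(C)\equiv \lambda_{n\ell}(C)\, q^{\frac{n(\ell-1)+w_{n\ell}(C)-w_n(C)}{2}} \pmod{\ell}.$$
   Context: An $\mathbb{F}_q$-linearized polynomial is $L(x)=\sum_i c_i x^{q^i}$ with $c_i\in\mathbb{F}_q$. For $m\ge1$, let $Q_m(x)=\mathrm{Tr}_{\mathbb{F}_{q^m}/\mathbb{F}_q}(xL(x))$, a quadratic form over $\mathbb{F}_q$ on $\mathbb{F}_{q^m}$; its radical is $\{x\in\mathbb{F}_{q^m}: Q_m(x+y)-Q_m(x)-Q_m(y)=0\ \forall y\in\mathbb{F}_{q^m}\}$ and $w_m(C)$ denotes its $\mathbb{F}_q$-dimension. The sign $\lambda_m(C)\in\{-1,0,1\}$ is defined by $\#\{x\in\mathbb{F}_{q^m}:Q_m(x)=0\}=q^{m-1}+\lambda_m(C)(q-1)q^{\frac{m+w_m(C)}{2}-1}$; equivalently $\#C(\mathbb{F}_{q^m})=q^m+1+\lambda_m(C)(q-1)q^{\frac{m+w_m(C)}{2}}$. One has $\lambda_m(C)=0$ iff $m-w_m(C)$ is odd. *)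

theory Defs
  imports "HOL-Analysis.Analysis" "HOL-Number_Theory.Number_Theory"
begin

text \<open>All objects live inside an ambient field of type 'a. The field with q^m elements
  is realised as the set of roots of X^(q^m) - X in 'a (which is F_{q^m} whenever 'a
  contains a copy of F_{q^m}, e.g. when 'a is finite with q^N elements and m divides N).\<close>

definition Fqm :: "nat \<Rightarrow> nat \<Rightarrow> 'a::field set" where
  "Fqm q m = {x. x ^ (q ^ m) = x}"

definition tr :: "nat \<Rightarrow> nat \<Rightarrow> 'a::field \<Rightarrow> 'a" where
  "tr q m x = (\<Sum>i<m. x ^ (q ^ i))"

definition linpoly :: "nat \<Rightarrow> (nat \<Rightarrow> 'a::field) \<Rightarrow> nat \<Rightarrow> 'a \<Rightarrow> 'a" where
  "linpoly q c d x = (\<Sum>i<d. c i * x ^ (q ^ i))"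

definition Qform :: "nat \<Rightarrow> (nat \<Rightarrow> 'a::field) \<Rightarrow> nat \<Rightarrow> nat \<Rightarrow> 'a \<Rightarrow> 'a" where
  "Qform q c d m x = tr q m (x * linpoly q c d x)"

definition radical :: "nat \<Rightarrow> (nat \<Rightarrow> 'a::field) \<Rightarrow> nat \<Rightarrow> nat \<Rightarrow> 'a set" where
  "radical q c d m = {x \<in> Fqm q m. \<forall>y \<in> Fqm q m.
      Qform q c d m (x + y) - Qform q c d m x - Qform q c d m y = 0}"

definition Fq_span :: "nat \<Rightarrow> 'a::field set \<Rightarrow> 'a set" where
  "Fq_span q B = {\<Sum>b\<in>B. f b * b | f. \<forall>b\<in>B. f b \<in> Fqm q 1}"

definition Fq_indep :: "nat \<Rightarrow> 'a::field set \<Rightarrow> bool" where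
  "Fq_indep q B = (\<forall>f. (\<forall>b\<in>B. f b \<in> Fqm q 1) \<and> (\<Sum>b\<in>B. f b * b) = 0 \<longrightarrow> (\<forall>b\<in>B. f b = 0))"

definition Fq_dim :: "nat \<Rightarrow> 'a::field set \<Rightarrow> nat" where
  "Fq_dim q V = card (SOME B. finite B \<and> B \<subseteq> V \<and> Fq_indep q B \<and> Fq_span q B = V)"

definition wdim :: "nat \<Rightarrow> (nat \<Rightarrow> 'a::field) \<Rightarrow> nat \<Rightarrow> nat \<Rightarrow> nat" where
  "wdim q c d m = Fq_dim q (radical q c d m)"

definition lam :: "nat \<Rightarrow> (nat \<Rightarrow> 'a::field) \<Rightarrow> nat \<Rightarrow> nat \<Rightarrow> int" where
  "lam q c d m = (THE l. l \<in> {-1, 0, 1} \<and>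
     real (card {x \<in> Fqm q m. Qform q c d m x = 0}) =
       real q ^ (m - 1) + real_of_int l * (real q - 1) *
         real q powr ((real m + real (wdim q c d m)) / 2 - 1))"

end

theory Submission
  imports Defs
begin

text \<open>Let \<open>Q\<close> be a quadratic form over the field with \<open>q\<close> elements, \<open>q\<close> odd, on a space \<open>V\<close> with radical
  of dimension \<open>w\<close>. Splitting off anisotropic lines one at a time and using the sums of the quadratic
  character over quadratic polynomials, one finds the size of every level set of \<open>Q\<close>; in even
  rank \<open>#{Q = a} = q^(m-1) - \<lambda> q^((m+w)/2-1)\<close> for every \<open>a \<noteq> 0\<close>. The Frobenius
  \<open>x \<mapsto> x^(q^n)\<close> has order dividing \<open>l\<close> on the field with \<open>q^(n l)\<close> elements and
  preserves \<open>{Q_(n l) = l}\<close>, with fixed points \<open>{Q_n = 1}\<close> because \<open>Q_(n l) = l Q_n\<close> on the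
  subfield. Hence both sets have the same size modulo \<open>l\<close>, and Fermat's little theorem turns this into
  the congruence. Counting zeros instead would lose the case \<open>l dvd q - 1\<close>, since the number of
  zeros involves \<open>\<lambda>\<close> only through \<open>(q - 1) \<lambda>\<close>.\<close>

section \<open>The quadratic character of a finite subfield\<close>

text \<open>Subfields are subsets of the ambient type, so the same closure facts serve the scalars
  and the larger field carrying the form.\<close>

locale finite_subfield =
  fixes F :: "'a::field set"
  assumes finite_F: "finite F"
    and one_mem: "1 \<in> F"
    and diff_mem: "x \<in> F \<Longrightarrow> y \<in> F \<Longrightarrow> x - y \<in> F"
    and mult_mem: "x \<in> F \<Longrightarrow> y \<in> F \<Longrightarrow> x * y \<in> F"
    and inverse_mem: "x \<in> F \<Longrightarrow> inverse x \<in> F"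
begin

lemma zero_mem: "0 \<in> F"
  using diff_mem[OF one_mem one_mem] by simp

lemma uminus_mem: "x \<in> F \<Longrightarrow> - x \<in> F"
  using diff_mem[OF zero_mem] by fastforce

lemma add_mem: "x \<in> F \<Longrightarrow> y \<in> F \<Longrightarrow> x + y \<in> F"
  using diff_mem[of x "- y"] uminus_mem by simp

lemma divide_mem: "x \<in> F \<Longrightarrow> y \<in> F \<Longrightarrow> x / y \<in> F"
  by (simp add: divide_inverse mult_mem inverse_mem)

lemma power_mem: "x \<in> F \<Longrightarrow> x ^ k \<in> F"
  by (induction k) (auto simp: one_mem mult_mem)

lemmas mem_intros = zero_mem one_mem diff_mem mult_mem inverse_mem uminus_mem add_mem divide_mem
  power_mem

lemma sum_mem: "(\<And>i. i \<in> I \<Longrightarrow> f i \<in> F) \<Longrightarrow> sum f I \<in> F"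
  by (induction I rule: infinite_finite_induct) (auto intro: mem_intros)

definition subspace :: "'a set \<Rightarrow> bool" where
  "subspace V \<longleftrightarrow> 0 \<in> V \<and> (\<forall>x\<in>V. \<forall>y\<in>V. x + y \<in> V) \<and> (\<forall>t\<in>F. \<forall>x\<in>V. t * x \<in> V)"

lemma subspace_zero: "subspace V \<Longrightarrow> 0 \<in> V"
  and subspace_add: "subspace V \<Longrightarrow> x \<in> V \<Longrightarrow> y \<in> V \<Longrightarrow> x + y \<in> V"
  and subspace_scale: "subspace V \<Longrightarrow> t \<in> F \<Longrightarrow> x \<in> V \<Longrightarrow> t * x \<in> V"
  by (auto simp: subspace_def)

lemma subspace_diff: "subspace V \<Longrightarrow> x \<in> V \<Longrightarrow> y \<in> V \<Longrightarrow> x - y \<in> V"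
  using subspace_add[of V x "- 1 * y"] subspace_scale[of V "- 1" y] by (simp add: mem_intros)

lemma subspace_sum: "subspace V \<Longrightarrow> (\<And>i. i \<in> I \<Longrightarrow> f i \<in> V) \<Longrightarrow> sum f I \<in> V"
  by (induction I rule: infinite_finite_induct) (auto simp: subspace_zero subspace_add)

end

locale odd_finite_subfield = finite_subfield +
  assumes two_nonzero: "(2::'a) \<noteq> 0"
begin

text \<open>Integer values keep character sums in characteristic 0. Nonzero arguments outside
  \<open>F\<close> receive \<open>- 1\<close>.\<close>

definition quad_char :: "'a \<Rightarrow> int" where
  "quad_char a = (if a = 0 then 0 else if \<exists>t\<in>F. a = t\<^sup>2 then 1 else - 1)"

lemma quad_char_zero [simp]: "quad_char 0 = 0"
  by (simp add: quad_char_def)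

lemma quad_char_square: "t \<in> F \<Longrightarrow> t \<noteq> 0 \<Longrightarrow> quad_char (t\<^sup>2) = 1"
  by (auto simp: quad_char_def)

lemma quad_char_values: "a \<noteq> 0 \<Longrightarrow> quad_char a \<in> {- 1, 1}"
  by (auto simp: quad_char_def)

text \<open>Turns root counts into character values: a nonzero square has the roots \<open>t\<close>
  and \<open>- t\<close>, distinct because 2 is invertible.\<close>

lemma card_square_roots: "int (card {t\<in>F. t\<^sup>2 = a}) = 1 + quad_char a"
proof (cases "\<exists>t\<in>F. a = t\<^sup>2")
  case True
  then obtain t where t: "t \<in> F" "a = t\<^sup>2" by blast
  have roots: "{s\<in>F. s\<^sup>2 = a} = {t, - t}"
    using t by (auto simp: power2_eq_iff uminus_mem)
  show ?thesis
  proof (cases "t = 0")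
    case False
    have "t \<noteq> - t"
    proof
      assume "t = - t"
      then have "2 * t = 0" by (metis add.right_inverse mult_2)
      with False two_nonzero show False by simp
    qed
    with False t show ?thesis unfolding roots by (simp add: quad_char_square)
  qed (use t roots in simp)
next
  case False
  then have "{t\<in>F. t\<^sup>2 = a} = {}" "a \<noteq> 0"
    using zero_mem by (auto simp: power2_eq_square)
  with False show ?thesis by (simp only: quad_char_def card.empty) simp
qed

lemma sum_card_fibres:
  assumes "finite A" "finite B" "f ` A \<subseteq> B"
  shows "(\<Sum>b\<in>B. card {a\<in>A. f a = b}) = card A"
  using sum.group[OF assms, of "\<lambda>_. 1::nat"] by simp

text \<open>Squaring maps \<open>F\<close> into itself, so the fibre sizes
  \<open>1 + quad_char a\<close> add up to \<open>card F\<close>.\<close>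

lemma sum_quad_char: "(\<Sum>a\<in>F. quad_char a) = 0"
proof -
  have "(\<Sum>a\<in>F. card {t\<in>F. t\<^sup>2 = a}) = card F"
    by (rule sum_card_fibres) (auto simp: finite_F mem_intros)
  then have "(\<Sum>a\<in>F. int (card {t\<in>F. t\<^sup>2 = a})) = int (card F)"
    by (metis of_nat_sum)
  then show ?thesis
    by (simp add: card_square_roots sum.distrib)
qed

lemma bij_betw_mult: "b \<in> F \<Longrightarrow> b \<noteq> 0 \<Longrightarrow> bij_betw ((*) b) F F"
  by (rule bij_betwI[where g = "\<lambda>x. x / b"]) (auto simp: mem_intros)

lemma quad_char_mult_square:
  assumes "t \<in> F" "t \<noteq> 0"
  shows "quad_char (t\<^sup>2 * b) = quad_char b"
proof -
  have "(\<exists>s\<in>F. t\<^sup>2 * b = s\<^sup>2) \<longleftrightarrow> (\<exists>s\<in>F. b = s\<^sup>2)"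
  proof
    assume "\<exists>s\<in>F. t\<^sup>2 * b = s\<^sup>2"
    then obtain s where "s \<in> F" "t\<^sup>2 * b = s\<^sup>2" by blast
    with assms show "\<exists>s\<in>F. b = s\<^sup>2"
      by (intro bexI[of _ "s / t"]) (auto simp: mem_intros power_divide field_simps)
  next
    assume "\<exists>s\<in>F. b = s\<^sup>2"
    with assms show "\<exists>s\<in>F. t\<^sup>2 * b = s\<^sup>2"
      by (metis mult_mem power_mult_distrib)
  qed
  with assms show ?thesis by (simp add: quad_char_def)
qed

lemma quad_char_nonsquare_mult:
  assumes "a \<in> F" "b \<in> F" "quad_char a = - 1" "quad_char b = - 1"
  shows "quad_char (a * b) = 1"
proof -
  have nz: "b \<noteq> 0" "a \<noteq> 0" using assms by auto
  \<comment> \<open>The non-positive terms below sum to zero, so they all vanish.\<close>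
  let ?f = "\<lambda>x. - (quad_char (b * x) + quad_char x)"
  \<comment> \<open>At a nonzero square the two values cancel; at a nonsquare,
    \<open>quad_char x = - 1\<close> cannot be outweighed by the other value.\<close>
  have "0 \<le> ?f x" if "x \<in> F" for x
  proof (cases "\<exists>t\<in>F. x = t\<^sup>2")
    case True
    then obtain t where t: "t \<in> F" "x = t\<^sup>2" by blast
    show ?thesis
    proof (cases "t = 0")
      case False
      with t assms quad_char_mult_square[of t b] show ?thesis
        by (simp add: quad_char_square mult.commute)
    qed (use t in simp)
  next
    case False
    with zero_mem have "x \<noteq> 0" by (metis zero_power2)
    with False have "quad_char x = - 1" by (simp add: quad_char_def)
    moreover have "quad_char (b * x) \<le> 1" by (simp add: quad_char_def)
    ultimately show ?thesis by simp
  qed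
  moreover have "(\<Sum>x\<in>F. quad_char (b * x)) = 0"
    using sum.reindex_bij_betw[OF bij_betw_mult, of b quad_char] assms nz sum_quad_char by simp
  then have "(\<Sum>x\<in>F. ?f x) = 0"
    by (simp only: sum_negf sum.distrib sum_quad_char)
  ultimately have "?f a = 0"
    using sum_nonneg_eq_0_iff[OF finite_F, of ?f] assms by blast
  with assms show ?thesis by (simp add: mult.commute)
qed

lemma quad_char_mult:
  assumes "a \<in> F" "b \<in> F"
  shows "quad_char (a * b) = quad_char a * quad_char b"
proof -
  have sq: "quad_char (x * y) = quad_char x * quad_char y" if "quad_char x = 1" for x y
  proof -
    from that obtain t where "t \<in> F" "x = t\<^sup>2" "t \<noteq> 0"
      by (auto simp: quad_char_def split: if_splits)
    with that show ?thesis by (simp add: quad_char_mult_square)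
  qed
  show ?thesis
  proof (cases "a = 0 \<or> b = 0")
    case False
    then have "quad_char a \<in> {- 1, 1}" "quad_char b \<in> {- 1, 1}"
      using quad_char_values by auto
    then show ?thesis
      using sq[of a b] sq[of b a] quad_char_nonsquare_mult[OF assms] by (auto simp: mult.commute)
  qed auto
qed

section \<open>Character sums over quadratic polynomials\<close>

lemma four_nonzero: "(4::'a) \<noteq> 0"
proof -
  have "(4::'a) = 2 * 2" by simp
  then show ?thesis using two_nonzero by (metis mult_eq_0_iff)
qed

text \<open>The equation factors as \<open>(t - s) * (t + s) = k\<close>, so its solutions are
  parametrized by the nonzero value \<open>u = t - s\<close>, with
  \<open>t + s = k / u\<close>.\<close>

lemma card_hyperbola:
  assumes "k \<in> F" "k \<noteq> 0"
  shows "card (SIGMA t:F. {s\<in>F. s\<^sup>2 = t\<^sup>2 - k}) = card F - 1"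
proof -
  have "bij_betw (\<lambda>(t, s). t - s) (SIGMA t:F. {s\<in>F. s\<^sup>2 = t\<^sup>2 - k}) (F - {0})"
  proof (rule bij_betwI[where g = "\<lambda>u. ((k / u + u) / 2, (k / u - u) / 2)"], goal_cases)
    case 1
    show ?case using assms by (auto simp: mem_intros)
  next
    case 2
    have half: "2 \<in> F" using add_mem[OF one_mem one_mem] by simp
    have eq: "((k / u - u) / 2)\<^sup>2 = ((k / u + u) / 2)\<^sup>2 - k" if "u \<noteq> 0" for u
      using that two_nonzero four_nonzero by (simp add: field_simps power2_eq_square)
    show ?case using assms by (auto simp: mem_intros half eq)
  next
    case (3 x)
    then obtain t s where ts: "x = (t, s)" "s\<^sup>2 = t\<^sup>2 - k" by auto
    then have k: "k = (t + s) * (t - s)" by (simp add: algebra_simps power2_eq_square)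
    with assms have "k / (t - s) = t + s" by auto
    with ts two_nonzero show ?case by (simp add: field_simps)
  next
    case (4 u)
    then show ?case using two_nonzero four_nonzero by (simp add: field_simps)
  qed
  then show ?thesis
    by (simp add: bij_betw_same_card zero_mem finite_F)
qed

lemma card_F_pos: "card F \<ge> 1"
  using finite_F zero_mem by (simp add: card_gt_0_iff Suc_le_eq) blast

text \<open>For \<open>a = 0\<close> every nonzero \<open>t\<close> contributes
  \<open>quad_char (- g)\<close>. Otherwise pulling out \<open>- g\<close> leaves
  \<open>t^2 - k\<close>, whose character sum is the hyperbola count minus
  \<open>card F\<close>.\<close>

lemma sum_quad_char_quadratic:
  assumes "a \<in> F" "g \<in> F" "g \<noteq> 0"
  shows "(\<Sum>t\<in>F. quad_char (a - t\<^sup>2 * g)) = quad_char (- g) * (int (card F) * of_bool (a = 0) - 1)"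
proof (cases "a = 0")
  case True
  have "quad_char (a - t\<^sup>2 * g) = quad_char (- g) * (1 - of_bool (t = 0))" if "t \<in> F" for t
    using quad_char_mult_square[of t "- g"] that True by auto
  then have "(\<Sum>t\<in>F. quad_char (a - t\<^sup>2 * g)) = quad_char (- g) * (\<Sum>t\<in>F. 1 - of_bool (t = 0))"
    by (simp add: sum_distrib_left)
  also have "(\<Sum>t\<in>F. 1 - of_bool (t = 0)) = int (card F) - 1"
  proof -
    have "F \<inter> {t. t = 0} = {0}" using zero_mem by auto
    then show ?thesis by (simp add: sum_subtractf finite_F)
  qed
  finally show ?thesis using True by simp
next
  case False
  define k where "k = a / g"
  have k: "k \<in> F" "k \<noteq> 0" using assms False by (auto simp: k_def mem_intros)
  have "(\<Sum>t\<in>F. int (card {s\<in>F. s\<^sup>2 = t\<^sup>2 - k})) = int (card (SIGMA t:F. {s\<in>F. s\<^sup>2 = t\<^sup>2 - k}))"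
    by (simp add: finite_F)
  also have "\<dots> = int (card F) - 1"
    using card_F_pos by (simp only: card_hyperbola[OF k] of_nat_diff of_nat_1)
  finally have "(\<Sum>t\<in>F. quad_char (t\<^sup>2 - k)) = - 1"
    by (simp add: card_square_roots sum.distrib)
  moreover have "quad_char (a - t\<^sup>2 * g) = quad_char (- g) * quad_char (t\<^sup>2 - k)" if "t \<in> F" for t
  proof -
    have "a - t\<^sup>2 * g = - g * (t\<^sup>2 - k)" using assms by (simp add: k_def algebra_simps)
    with that assms k show ?thesis by (simp only: quad_char_mult mem_intros)
  qed
  ultimately show ?thesis using False
    by (simp flip: sum_distrib_left)
qed

end

section \<open>Level sets of quadratic forms\<close>

text \<open>The quadratic form is the diagonal \<open>\<beta> x x\<close>. Values in
  \<open>F\<close> are demanded only on the space in question, because the trace of an arbitrary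
  ambient element need not be a scalar.\<close>

locale quadratic_space = odd_finite_subfield F for F :: "'a::field set" +
  fixes \<beta> :: "'a \<Rightarrow> 'a \<Rightarrow> 'a"
  assumes form_add: "\<beta> (x + y) z = \<beta> x z + \<beta> y z"
    and form_scale: "t \<in> F \<Longrightarrow> \<beta> (t * x) z = t * \<beta> x z"
    and form_sym: "\<beta> x y = \<beta> y x"
begin

definition rad :: "'a set \<Rightarrow> 'a set" where
  "rad V = {x\<in>V. \<forall>y\<in>V. \<beta> x y = 0}"

definition reps :: "'a set \<Rightarrow> 'a \<Rightarrow> nat" where
  "reps V a = card {x\<in>V. \<beta> x x = a}"

lemma form_zero: "\<beta> 0 z = 0"
  using form_scale[OF zero_mem, of 0 z] by simp

lemma subspace_rad:
  assumes "subspace V"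
  shows "subspace (rad V)"
  using assms unfolding subspace_def rad_def by (auto simp: form_zero form_add form_scale)

definition perp :: "'a \<Rightarrow> 'a set \<Rightarrow> 'a set" where
  "perp v V = {x\<in>V. \<beta> x v = 0}"

lemma subspace_perp: "subspace V \<Longrightarrow> subspace (perp v V)"
  unfolding subspace_def perp_def by (auto simp: form_zero form_add form_scale)

section \<open>Splitting off an anisotropic line\<close>

context
  fixes V v
  assumes V: "finite V" "subspace V" "\<And>x y. x \<in> V \<Longrightarrow> y \<in> V \<Longrightarrow> \<beta> x y \<in> F"
    and v: "v \<in> V" "\<beta> v v \<noteq> 0"
begin

text \<open>Orthogonal projection onto \<open>v\<close>: the coefficient
  \<open>\<beta> y v / \<beta> v v\<close> makes sense because \<open>v\<close> is
  anisotropic.\<close>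

lemma bij_betw_split: "bij_betw (\<lambda>(t, x). t * v + x) (F \<times> perp v V) V"
proof (rule bij_betwI[where g = "\<lambda>y. (\<beta> y v / \<beta> v v, y - \<beta> y v / \<beta> v v * v)"], goal_cases)
  case 1
  show ?case using V v by (auto simp: perp_def subspace_def)
next
  case 2
  have coeff: "\<beta> y v / \<beta> v v \<in> F" if "y \<in> V" for y
    using that V v by (simp add: divide_mem)
  have "\<beta> (y - \<beta> y v / \<beta> v v * v) v = 0" if "y \<in> V" for y
  proof -
    have "\<beta> y v = \<beta> (y - \<beta> y v / \<beta> v v * v) v + \<beta> (\<beta> y v / \<beta> v v * v) v"
      by (simp flip: form_add)
    also have "\<beta> (\<beta> y v / \<beta> v v * v) v = \<beta> y v"
      using form_scale[OF coeff[OF that], of v v] v by simp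
    finally show ?thesis by simp
  qed
  with coeff V v show ?case
    by (auto simp: perp_def intro!: subspace_diff subspace_scale simp del: times_divide_eq_left)
next
  case (3 p)
  then obtain t x where p: "p = (t, x)" "t \<in> F" "\<beta> x v = 0" by (auto simp: perp_def)
  then have "\<beta> (t * v + x) v = t * \<beta> v v" by (simp add: form_add form_scale)
  with p v show ?case by simp
qed simp

lemma split_cases:
  assumes "y \<in> V"
  obtains t x where "t \<in> F" "x \<in> perp v V" "y = t * v + x"
proof -
  have "y \<in> (\<lambda>(t, x). t * v + x) ` (F \<times> perp v V)"
    using assms by (simp only: bij_betw_imp_surj_on[OF bij_betw_split])
  with that show ?thesis by auto
qed

lemma form_split:
  assumes "t \<in> F" "x \<in> perp v V"
  shows "\<beta> (t * v + x) (t * v + x) = t\<^sup>2 * \<beta> v v + \<beta> x x"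
proof -
  have "\<beta> x v = 0" "\<beta> v x = 0" using assms form_sym[of v x] by (auto simp: perp_def)
  then have "\<beta> x (t * v + x) = \<beta> x x" "\<beta> v (t * v + x) = t * \<beta> v v"
    using form_sym[of x "t * v + x"] form_sym[of v "t * v + x"] assms by (simp_all add: form_add form_scale)
  with assms show ?thesis by (simp add: form_add form_scale power2_eq_square)
qed

lemma card_perp: "card V = card F * card (perp v V)"
  using bij_betw_same_card[OF bij_betw_split] by (simp add: card_cartesian_product)

text \<open>By orthogonality the form is \<open>t^2 * \<beta> v v\<close> plus its value on the
  complement, so solutions are fibred over \<open>t\<close>.\<close>

lemma reps_split: "reps V a = (\<Sum>t\<in>F. reps (perp v V) (a - t\<^sup>2 * \<beta> v v))"
proof -
  have fin: "finite (perp v V)" using V by (simp add: perp_def)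
  let ?S = "SIGMA t:F. {x\<in>perp v V. \<beta> x x = a - t\<^sup>2 * \<beta> v v}"
  have "(\<lambda>(t, x). t * v + x) ` ?S = {y\<in>V. \<beta> y y = a}"
  proof (intro equalityI subsetI)
    fix y assume "y \<in> (\<lambda>(t, x). t * v + x) ` ?S"
    then show "y \<in> {y\<in>V. \<beta> y y = a}"
      using bij_betw_imp_surj_on[OF bij_betw_split] by (auto simp: form_split)
  next
    fix y assume y: "y \<in> {y\<in>V. \<beta> y y = a}"
    then obtain t x where tx: "t \<in> F" "x \<in> perp v V" "y = t * v + x"
      by (auto elim: split_cases)
    with y form_split[OF tx(1,2)] have "(t, x) \<in> ?S"
      by (auto simp: eq_diff_eq add.commute)
    with tx show "y \<in> (\<lambda>(t, x). t * v + x) ` ?S" by force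
  qed
  then have "bij_betw (\<lambda>(t, x). t * v + x) ?S {y\<in>V. \<beta> y y = a}"
    by (intro bij_betw_subset[OF bij_betw_split]) auto
  then have "reps V a = card ?S" by (simp add: reps_def bij_betw_same_card)
  with fin show ?thesis by (simp add: reps_def finite_F)
qed

text \<open>Elements of the complement are orthogonal to \<open>v\<close> already. Each split thus
  lowers the rank by one and leaves the radical alone.\<close>

lemma rad_perp: "rad (perp v V) = rad V"
proof (intro equalityI subsetI)
  fix x assume x: "x \<in> rad (perp v V)"
  have "\<beta> x y = 0" if "y \<in> V" for y
  proof -
    from that obtain t z where tz: "t \<in> F" "z \<in> perp v V" "y = t * v + z"
      by (rule split_cases)
    have "\<beta> y x = t * \<beta> v x + \<beta> z x" using tz by (simp add: form_add form_scale)
    with x tz show ?thesis using form_sym[of x y] form_sym[of x v] form_sym[of x z]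
      by (simp add: rad_def perp_def)
  qed
  with x show "x \<in> rad V" by (simp add: rad_def perp_def)
qed (use v in \<open>auto simp: rad_def perp_def\<close>)

end

text \<open>Rank \<open>2 * k\<close> with sign \<open>s\<close>. The factor \<open>card F\<close>
  on the left avoids an exponent lowered by one; the last factor is \<open>card F - 1\<close> at
  zero and \<open>- 1\<close> elsewhere.\<close>

definition even_rank_counts :: "'a set \<Rightarrow> nat \<Rightarrow> int \<Rightarrow> bool" where
  "even_rank_counts V k s \<longleftrightarrow> card V = card F ^ (2 * k) * card (rad V) \<and>
     (\<forall>a\<in>F. int (card F) * int (reps V a) =
        int (card V) + s * (int (card F) ^ k * int (card (rad V))) * (int (card F) * of_bool (a = 0) - 1))"

text \<open>Rank \<open>2 * k + 1\<close>: the main term is \<open>card V\<close> divided by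
  \<open>card F\<close>, and the deviation follows the character, so it vanishes at zero.\<close>

definition odd_rank_counts :: "'a set \<Rightarrow> nat \<Rightarrow> int \<Rightarrow> bool" where
  "odd_rank_counts V k s \<longleftrightarrow> card V = card F ^ (2 * k + 1) * card (rad V) \<and>
     (\<forall>a\<in>F. int (reps V a) =
        int (card F) ^ (2 * k) * int (card (rad V)) +
        s * (int (card F) ^ k * int (card (rad V))) * quad_char a)"

text \<open>Splitting off the line spanned by an anisotropic vector switches between the two cases.\<close>

lemma reps_classification:
  assumes "finite V" "subspace V" "\<And>x y. x \<in> V \<Longrightarrow> y \<in> V \<Longrightarrow> \<beta> x y \<in> F"
  shows "\<exists>k s. s \<in> {- 1, 1} \<and> (even_rank_counts V k s \<or> odd_rank_counts V k s)"
  using assms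
proof (induction "card V" arbitrary: V rule: less_induct)
  case less
  show ?case
  proof (cases "\<forall>x\<in>V. \<beta> x x = 0")
    case True
    \<comment> \<open>Polarization: with 2 invertible, a form vanishing on the diagonal is zero.
      This is rank 0.\<close>
    have "\<beta> x y = 0" if "x \<in> V" "y \<in> V" for x y
    proof -
      have "\<beta> (x + y) (x + y) = \<beta> x x + \<beta> y y + 2 * \<beta> x y"
        using form_sym[of x "x + y"] form_sym[of y "x + y"] form_sym[of x y] by (simp add: form_add)
      with True that less.prems(2) two_nonzero show ?thesis by (simp add: subspace_def)
    qed
    then have "rad V = V" by (auto simp: rad_def)
    moreover have "int (card F) * int (reps V a) =
        int (card V) + int (card V) * (int (card F) * of_bool (a = 0) - 1)" for a
    proof -
      have "{x\<in>V. \<beta> x x = a} = (if a = 0 then V else {})" using True by auto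
      then show ?thesis by (simp add: reps_def algebra_simps)
    qed
    ultimately have "even_rank_counts V 0 1" by (simp add: even_rank_counts_def)
    then show ?thesis by blast
  next
    case False
    then obtain v where v: "v \<in> V" "\<beta> v v \<noteq> 0" by blast
    let ?P = "perp v V" and ?g = "\<beta> v v"
    note V = less.prems
    have g: "?g \<in> F" using V v by blast
    have "?P \<subset> V" using v by (auto simp: perp_def)
    then have lt: "card ?P < card V" by (simp add: V psubset_card_mono)
    have fin: "finite ?P" using V by (simp add: perp_def)
    have inF: "\<beta> x y \<in> F" if "x \<in> ?P" "y \<in> ?P" for x y
      using that V by (simp add: perp_def)
    have arg: "a - t\<^sup>2 * ?g \<in> F" if "a \<in> F" "t \<in> F" for a t
      using that g by (intro mem_intros)
    have card: "card V = card F * card ?P" by (rule card_perp[OF V v])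
    have rad: "rad ?P = rad V" by (rule rad_perp[OF V v])
    have reps: "int (reps V a) = (\<Sum>t\<in>F. int (reps ?P (a - t\<^sup>2 * ?g)))" for a
      using reps_split[OF V v] by simp
    define q where "q = int (card F)"
    define R where "R = int (card (rad V))"
    from less.hyps[OF lt fin subspace_perp[OF V(2)] inF] obtain k s where s: "s \<in> {- 1, 1}"
      and "even_rank_counts ?P k s \<or> odd_rank_counts ?P k s"
      by blast
    then consider
      (even) "card ?P = card F ^ (2 * k) * card (rad V)"
        "\<And>a. a \<in> F \<Longrightarrow> q * int (reps ?P a) =
            int (card ?P) + s * (q ^ k * R) * (q * of_bool (a = 0) - 1)" |
      (odd) "card ?P = card F ^ (2 * k + 1) * card (rad V)"
        "\<And>a. a \<in> F \<Longrightarrow> int (reps ?P a) = q ^ (2 * k) * R + s * (q ^ k * R) * quad_char a"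
      unfolding even_rank_counts_def odd_rank_counts_def rad q_def R_def by blast
    then show ?thesis
    proof cases
      case even
      have q0: "q \<noteq> 0" using card_F_pos by (simp add: q_def)
      \<comment> \<open>The special terms are those with \<open>t^2 = a / ?g\<close>, of which there
        are \<open>1 + quad_char a * quad_char (1 / ?g)\<close>; the 1 cancels against the sum of
        the \<open>- 1\<close> terms.\<close>
      define s' where "s' = s * quad_char (1 / ?g)"
      have s': "s' \<in> {- 1, 1}" using s v quad_char_values[of "1 / ?g"] by (auto simp: s'_def)
      have "int (reps V a) = q ^ (2 * k) * R + s' * (q ^ k * R) * quad_char a" if a: "a \<in> F" for a
      proof -
        have "(\<Sum>t\<in>F. of_bool (a - t\<^sup>2 * ?g = 0)) = int (card {t\<in>F. t\<^sup>2 = a / ?g})"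
        proof -
          have "F \<inter> {t. a - t\<^sup>2 * ?g = 0} = {t\<in>F. t\<^sup>2 = a / ?g}"
            using v by (auto simp: field_simps)
          then show ?thesis by (simp add: finite_F)
        qed
        also have "\<dots> = 1 + quad_char a * quad_char (1 / ?g)"
          using quad_char_mult[of a "1 / ?g"] a g by (simp add: card_square_roots mem_intros)
        finally have roots: "(\<Sum>t\<in>F. of_bool (a - t\<^sup>2 * ?g = 0)) = 1 + quad_char a * quad_char (1 / ?g)" .
        have "q * int (reps V a) = (\<Sum>t\<in>F. q * int (reps ?P (a - t\<^sup>2 * ?g)))"
          by (simp add: reps sum_distrib_left)
        also have "\<dots> = (\<Sum>t\<in>F. int (card ?P) + s * (q ^ k * R) * (q * of_bool (a - t\<^sup>2 * ?g = 0) - 1))"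
          by (intro sum.cong refl even(2) arg a)
        also have "\<dots> = q * int (card ?P) +
            s * (q ^ k * R) * (q * (\<Sum>t\<in>F. of_bool (a - t\<^sup>2 * ?g = 0)) - q)"
          by (simp only: sum.distrib sum_distrib_left[symmetric] sum_subtractf) (simp add: q_def)
        also have "\<dots> = q * (q ^ (2 * k) * R + s' * (q ^ k * R) * quad_char a)"
          unfolding roots even(1) by (simp add: s'_def q_def R_def algebra_simps)
        finally show ?thesis using q0 by simp
      qed
      moreover have "card V = card F ^ (2 * k + 1) * card (rad V)"
        using card even(1) by simp
      ultimately have "odd_rank_counts V k s'"
        by (simp add: odd_rank_counts_def q_def R_def)
      with s' show ?thesis by blast
    next
      case odd
      \<comment> \<open>The sign \<open>quad_char (- ?g)\<close> comes from the quadratic character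
        sum, which already has the shape of the even-rank deviation.\<close>
      define s' where "s' = s * quad_char (- ?g)"
      have s': "s' \<in> {- 1, 1}" using s v quad_char_values[of "- ?g"] by (auto simp: s'_def)
      have card_V: "card V = card F ^ (2 * Suc k) * card (rad V)"
        using card odd(1) by simp
      have "q * int (reps V a) =
          int (card V) + s' * (q ^ Suc k * R) * (q * of_bool (a = 0) - 1)" if a: "a \<in> F" for a
      proof -
        have "int (reps V a) = (\<Sum>t\<in>F. q ^ (2 * k) * R + s * (q ^ k * R) * quad_char (a - t\<^sup>2 * ?g))"
          unfolding reps by (intro sum.cong refl odd(2) arg a)
        also have "\<dots> = q * (q ^ (2 * k) * R) + s * (q ^ k * R) * (\<Sum>t\<in>F. quad_char (a - t\<^sup>2 * ?g))"
          by (simp only: sum.distrib sum_distrib_left[symmetric]) (simp add: q_def)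
        also have "\<dots> = q * (q ^ (2 * k) * R) + s' * (q ^ k * R) * (q * of_bool (a = 0) - 1)"
          unfolding sum_quad_char_quadratic[OF a g v(2)] s'_def q_def by (simp only: mult_ac)
        finally have eq: "int (reps V a) =
            q * (q ^ (2 * k) * R) + s' * (q ^ k * R) * (q * of_bool (a = 0) - 1)" .
        have card_V': "int (card V) = q * (q * (q ^ (2 * k) * R))"
          by (simp add: card_V q_def R_def)
        show ?thesis unfolding eq card_V' by (simp add: algebra_simps)
      qed
      then have "even_rank_counts V (Suc k) s'"
        unfolding even_rank_counts_def q_def R_def using card_V by blast
      with s' show ?thesis by blast
    qed
  qed
qed

end

section \<open>Dimension\<close>

text \<open>\<open>Fq_dim\<close> picks a basis by choice, so one must exist: a maximal independent
  subset. Unique coordinates in a basis then give the cardinality.\<close>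

lemma (in finite_subfield) card_subspace:
  assumes F: "F = Fqm q 1" and W: "finite W" "subspace W"
  shows "card W = card F ^ Fq_dim q W"
proof -
  have span: "card (Fq_span q B) = card F ^ card B" if B: "finite B" "Fq_indep q B" for B :: "'a set"
  proof -
    let ?S = "\<lambda>f. \<Sum>b\<in>B. f b * b"
    \<comment> \<open>Extensional functions are determined by their values on \<open>B\<close>;
      independence applies to their difference.\<close>
    have inj: "inj_on ?S (B \<rightarrow>\<^sub>E F)"
    proof (rule inj_onI)
      fix f g assume fg: "f \<in> B \<rightarrow>\<^sub>E F" "g \<in> B \<rightarrow>\<^sub>E F" "?S f = ?S g"
      have "?S (\<lambda>b. f b - g b) = 0" using fg by (simp add: left_diff_distrib sum_subtractf)
      moreover have "\<forall>b\<in>B. f b - g b \<in> F"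
        using fg(1,2) by (blast intro: diff_mem dest: PiE_mem)
      ultimately have "\<forall>b\<in>B. f b - g b = 0"
        using B(2)[unfolded Fq_indep_def F[symmetric], rule_format, of "\<lambda>b. f b - g b"] by blast
      then show "f = g" by (intro PiE_ext[OF fg(1,2)]) simp
    qed
    have image: "?S ` (B \<rightarrow>\<^sub>E F) = Fq_span q B"
    proof (intro equalityI subsetI)
      fix x assume "x \<in> Fq_span q B"
      then obtain f where f: "\<forall>b\<in>B. f b \<in> F" "x = ?S f" unfolding Fq_span_def F by blast
      then have "restrict f B \<in> B \<rightarrow>\<^sub>E F" "x = ?S (restrict f B)" by simp_all
      then show "x \<in> ?S ` (B \<rightarrow>\<^sub>E F)" by blast
    next
      fix x assume "x \<in> ?S ` (B \<rightarrow>\<^sub>E F)"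
      then obtain f where "f \<in> B \<rightarrow>\<^sub>E F" "x = ?S f" by blast
      then show "x \<in> Fq_span q B"
        unfolding Fq_span_def F[symmetric] by (blast dest: PiE_mem)
    qed
    show ?thesis
      using card_image[OF inj] card_funcsetE[OF B(1), of F] unfolding image by (rule trans)
  qed
  define is_basis where
    "is_basis B \<longleftrightarrow> finite B \<and> B \<subseteq> W \<and> Fq_indep q B \<and> Fq_span q B = W" for B
  have "\<exists>B. is_basis B"
  proof -
    let ?I = "{B. B \<subseteq> W \<and> Fq_indep q B}"
    have "{} \<in> ?I" by (simp add: Fq_indep_def)
    moreover have "finite ?I" using W by simp
    ultimately obtain B where B: "B \<subseteq> W" "Fq_indep q B"
      and max: "\<And>B'. B' \<subseteq> W \<Longrightarrow> Fq_indep q B' \<Longrightarrow> B \<subseteq> B' \<Longrightarrow> B = B'"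
      using finite_has_maximal[of ?I] by (metis (no_types, lifting) empty_iff mem_Collect_eq)
    have fin: "finite B" using B W finite_subset by blast
    have "w \<in> Fq_span q B" if w: "w \<in> W" for w
    proof (cases "w \<in> B")
      case True
      have "B \<inter> {b. b = w} = {w}" using True by auto
      then have "w = (\<Sum>b\<in>B. of_bool (b = w) * b)" using fin by simp
      moreover have "\<forall>b\<in>B. of_bool (b = w) \<in> F" by (simp add: of_bool_def zero_mem one_mem)
      ultimately show ?thesis unfolding Fq_span_def F[symmetric]
        by (intro CollectI exI[of _ "\<lambda>b. of_bool (b = w)"] conjI)
    next
      case False
      \<comment> \<open>By maximality, adjoining \<open>w\<close> creates a relation. As
        \<open>B\<close> is independent, \<open>w\<close> has a nonzero coefficient in it, and the
        relation can be solved for \<open>w\<close>.\<close>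
      with w B max[of "insert w B"] have "\<not> Fq_indep q (insert w B)" by blast
      then obtain f where f: "\<forall>b\<in>insert w B. f b \<in> F" "(\<Sum>b\<in>insert w B. f b * b) = 0"
        "\<exists>b\<in>insert w B. f b \<noteq> 0"
        unfolding Fq_indep_def F[symmetric] by blast
      have sum: "f w * w + (\<Sum>b\<in>B. f b * b) = 0" using f(2) False fin by simp
      have fw: "f w \<noteq> 0"
      proof
        assume fw: "f w = 0"
        with sum f(1) B(2) have "\<forall>b\<in>B. f b = 0" unfolding Fq_indep_def F[symmetric] by simp
        with fw f(3) show False by blast
      qed
      have "w = (\<Sum>b\<in>B. - f b / f w * b)"
      proof -
        have "(\<Sum>b\<in>B. - f b / f w * b) = - (\<Sum>b\<in>B. f b * b) / f w"
          by (simp add: sum_negf sum_divide_distrib)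
        also have "- (\<Sum>b\<in>B. f b * b) = f w * w" using sum by (metis add.commute minus_unique)
        finally show ?thesis using fw by simp
      qed
      moreover have "\<forall>b\<in>B. - f b / f w \<in> F" using f(1) by (auto intro!: mem_intros)
      ultimately show ?thesis unfolding Fq_span_def F[symmetric]
        by (intro CollectI exI[of _ "\<lambda>b. - f b / f w"] conjI)
    qed
    moreover have "Fq_span q B \<subseteq> W"
      unfolding Fq_span_def F[symmetric] using B W by (auto intro!: subspace_sum subspace_scale)
    ultimately have "is_basis B" using B fin by (auto simp: is_basis_def)
    then show ?thesis ..
  qed
  then have "is_basis (SOME B. is_basis B)" by (rule someI_ex)
  moreover have "Fq_dim q W = card (SOME B. is_basis B)"
    by (simp add: Fq_dim_def is_basis_def)
  ultimately show ?thesis using span by (metis is_basis_def)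
qed

section \<open>Subfields of a finite field\<close>

text \<open>Multiplication by \<open>x\<close> permutes the nonzero elements and so preserves their
  product.\<close>

lemma power_CARD_minus_1:
  fixes x :: "'a::{field,finite}"
  assumes "x \<noteq> 0"
  shows "x ^ (CARD('a) - 1) = 1"
proof -
  have "bij_betw ((*) x) (UNIV - {0}) (UNIV - {0})"
    by (rule bij_betwI[where g = "\<lambda>y. y / x"]) (use assms in auto)
  then have "\<Prod>(UNIV - {0}) = (\<Prod>y\<in>UNIV - {0}. x * y)"
    by (simp add: prod.reindex_bij_betw[where g = "\<lambda>y. y"])
  also have "\<dots> = x ^ (CARD('a) - 1) * \<Prod>(UNIV - {0})"
    by (simp add: prod.distrib card_Diff_singleton)
  finally show ?thesis by (simp add: prod_zero_iff)
qed

text \<open>With \<open>CARD('a) - 1 = d * s\<close>, every nonzero element is a root of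
  \<open>X^(d * s) - 1\<close>, which is \<open>X^d - 1\<close> times a cofactor of degree at most
  \<open>d * (s - 1)\<close>. Hence at least \<open>d\<close> roots are left for the first
  factor.\<close>

lemma card_roots_of_unity:
  assumes "d dvd CARD('a) - 1"
  shows "card {x::'a::{field,finite}. x ^ d = 1} = d"
proof -
  have "card {0, 1::'a} \<le> CARD('a)" by (rule card_mono) auto
  then have N: "CARD('a) \<ge> 2" by simp
  from assms obtain s where s: "CARD('a) - 1 = d * s" by blast
  with N have pos: "d > 0" "s > 0" by (auto intro!: Nat.gr0I)
  define P :: "'a poly" where "P = Polynomial.monom 1 d - 1"
  define H :: "'a poly" where "H = (\<Sum>j<s. Polynomial.monom 1 (d * j))"
  have P: "P \<noteq> 0" "Polynomial.degree P \<le> d" "\<And>x. poly P x = x ^ d - 1"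
  proof -
    have "Polynomial.coeff P 0 = - 1" using pos by (simp add: P_def)
    then show "P \<noteq> 0" by auto
    show "Polynomial.degree P \<le> d" unfolding P_def by (intro degree_diff_le) (auto simp: Polynomial.degree_monom_le)
  qed (simp add: P_def poly_monom)
  have H: "H \<noteq> 0" "Polynomial.degree H \<le> d * (s - 1)" "\<And>x. poly H x = (\<Sum>j<s. (x ^ d) ^ j)"
  proof -
    have "Polynomial.coeff H 0 = (\<Sum>j<s. of_bool (j = 0))"
      unfolding H_def Polynomial.coeff_sum using pos by (intro sum.cong) auto
    also have "\<dots> = 1" using pos by simp
    finally show "H \<noteq> 0" by auto
    show "Polynomial.degree H \<le> d * (s - 1)" unfolding H_def
      by (intro degree_sum_le) (auto intro!: order.trans[OF Polynomial.degree_monom_le])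
  qed (simp add: H_def poly_sum poly_monom power_mult)
  have "x ^ d = 1 \<or> poly H x = 0" if "x \<noteq> 0" for x :: 'a
  proof -
    have "(x ^ d - 1) * poly H x = x ^ (d * s) - 1"
      unfolding H power_mult by (rule power_diff_1_eq[symmetric])
    with power_CARD_minus_1[OF that] s show ?thesis by simp
  qed
  then have "UNIV - {0::'a} \<subseteq> {x. x ^ d = 1} \<union> {x. poly H x = 0}" by auto
  then have "CARD('a) - 1 \<le> card ({x::'a. x ^ d = 1} \<union> {x. poly H x = 0})"
    using card_mono[of "{x. x ^ d = 1} \<union> {x. poly H x = 0}" "UNIV - {0::'a}"]
    by (simp add: card_Diff_singleton)
  also have "\<dots> \<le> card {x::'a. x ^ d = 1} + card {x. poly H x = 0}" by (rule card_Un_le)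
  also have "card {x. poly H x = 0} \<le> d * (s - 1)"
    using card_poly_roots_bound[OF H(1)] H(2) by simp
  finally have "d * s \<le> card {x::'a. x ^ d = 1} + d * (s - 1)" using s by simp
  then have "d \<le> card {x::'a. x ^ d = 1}" using pos by (cases s) auto
  moreover have "card {x::'a. x ^ d = 1} \<le> d"
    using card_poly_roots_bound[OF P(1)] P(2,3) by simp
  ultimately show ?thesis by simp
qed

lemma pow_minus_one_dvd: "m dvd k \<Longrightarrow> (q::nat) ^ m - 1 dvd q ^ k - 1"
proof (elim dvdE)
  fix j assume k: "k = m * j"
  show "q ^ m - 1 dvd q ^ k - 1"
  proof (cases "q = 0")
    case False
    have "int (q ^ m) - 1 dvd int (q ^ m) ^ j - 1"
      unfolding power_diff_1_eq by (rule dvd_triv_left)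
    moreover have "int (q ^ m) - 1 = int (q ^ m - 1)" "int (q ^ m) ^ j - 1 = int (q ^ k - 1)"
      using False by (simp_all add: of_nat_diff k power_mult)
    ultimately show ?thesis by (simp only: of_nat_dvd_iff)
  qed (simp add: k power_0_left)
qed

locale field_of_odd_order =
  fixes p e q M :: nat and type_token :: "'a::{field,finite} itself"
  assumes prime_p: "prime p" and odd_p: "odd p" and e_pos: "e \<ge> 1" and q: "q = p ^ e"
    and CARD: "CARD('a) = q ^ M"
begin

lemma CHAR: "CHAR('a) = p"
proof -
  have "prime CHAR('a)" by (rule prime_CHAR_semidom) (simp add: finite_imp_CHAR_pos)
  moreover have "CHAR('a) dvd p ^ (e * M)"
    using CHAR_dvd_CARD[where 'a = 'a] CARD by (simp add: q power_mult)
  ultimately show ?thesis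
    using prime_p by (meson prime_dvd_power primes_dvd_imp_eq)
qed

lemma of_nat_eq_0: "of_nat k = (0::'a) \<longleftrightarrow> p dvd k"
  by (simp add: of_nat_eq_0_iff_char_dvd CHAR)

lemma two_nonzero: "(2::'a) \<noteq> 0"
proof -
  have "\<not> p dvd 2" using prime_p odd_p primes_dvd_imp_eq[OF _ two_is_prime_nat] by blast
  then show ?thesis using of_nat_eq_0[of 2] by simp
qed

lemma q_gt_1: "q > 1"
  using prime_p e_pos prime_gt_1_nat[of p] unfolding q by (intro one_less_power) auto

section \<open>Frobenius and trace\<close>

lemma frob_add: "((x::'a) + y) ^ (q ^ i) = x ^ (q ^ i) + y ^ (q ^ i)"
  by (rule freshmans_dream'[where n = "e * i"]) (simp_all add: CHAR prime_p q power_mult)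

lemma frob_sum: "(sum f A :: 'a) ^ (q ^ i) = (\<Sum>x\<in>A. f x ^ (q ^ i))"
  by (rule freshmans_dream_sum'[where n = "e * i"]) (simp_all add: CHAR prime_p q power_mult)

lemma frob_diff: "((x::'a) - y) ^ (q ^ i) = x ^ (q ^ i) - y ^ (q ^ i)"
  using frob_add[of "x - y" y i] by (simp add: algebra_simps)

lemma finite_subfield_Fqm: "finite_subfield (Fqm q m :: 'a set)"
  by unfold_locales (auto simp: Fqm_def frob_diff power_mult_distrib power_inverse)

text \<open>The nonzero elements are the roots of \<open>X^(q^m - 1) - 1\<close>, and
  \<open>q^m - 1\<close> divides \<open>q^M - 1\<close> because \<open>m\<close> divides
  \<open>M\<close>.\<close>

lemma card_Fqm:
  assumes "m \<ge> 1" "m dvd M"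
  shows "card (Fqm q m :: 'a set) = q ^ m"
proof -
  have qm: "q ^ m > 1" using q_gt_1 assms by (intro one_less_power) auto
  have "x ^ (q ^ m) = x \<longleftrightarrow> x = 0 \<or> x ^ (q ^ m - 1) = 1" for x :: 'a
  proof -
    have "q ^ m = Suc (q ^ m - 1)" using qm by simp
    then have "x ^ (q ^ m) = x ^ Suc (q ^ m - 1)" by (rule arg_cong)
    then have "x ^ (q ^ m) = x * x ^ (q ^ m - 1)" by (simp only: power_Suc)
    then show ?thesis by simp
  qed
  then have "Fqm q m = insert (0::'a) {x. x ^ (q ^ m - 1) = 1}" by (auto simp: Fqm_def)
  moreover have "card {x::'a. x ^ (q ^ m - 1) = 1} = q ^ m - 1"
    using pow_minus_one_dvd[OF assms(2)] by (intro card_roots_of_unity) (simp add: CARD)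
  ultimately show ?thesis using qm by (simp add: power_0_left)
qed

lemma Fqm_mono: "Fqm q 1 \<subseteq> (Fqm q m :: 'a set)"
proof
  fix x :: 'a assume "x \<in> Fqm q 1"
  then have "x ^ q = x" by (simp add: Fqm_def)
  then have "x ^ (q ^ m) = x" by (induction m) (simp_all add: power_mult)
  then show "x \<in> Fqm q m" by (simp add: Fqm_def)
qed

lemma Fq_frob: "x \<in> Fqm q 1 \<Longrightarrow> (x::'a) ^ (q ^ i) = x"
  using Fqm_mono[of i] by (auto simp: Fqm_def)

lemma tr_add: "tr q m ((x::'a) + y) = tr q m x + tr q m y"
  by (simp add: tr_def frob_add sum.distrib)

lemma tr_scale: "t \<in> Fqm q 1 \<Longrightarrow> tr q m ((t::'a) * x) = t * tr q m x"
  by (simp add: tr_def power_mult_distrib Fq_frob sum_distrib_left)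

text \<open>Raising to the power \<open>q\<close> shifts the conjugates by one place, and the last
  wraps around to \<open>x\<close>.\<close>

lemma tr_mem:
  assumes "(x::'a) \<in> Fqm q m"
  shows "tr q m x \<in> Fqm q 1"
proof -
  have "tr q m x ^ q = (\<Sum>i<m. x ^ (q ^ Suc i))"
    using frob_sum[of "\<lambda>i. x ^ (q ^ i)" "{..<m}" 1] by (simp add: tr_def mult.commute flip: power_mult)
  also have "\<dots> = (\<Sum>i<Suc m. x ^ (q ^ i)) - x"
    by (subst sum.lessThan_Suc_shift) simp
  also have "\<dots> = tr q m x" using assms by (simp add: tr_def Fqm_def)
  finally show ?thesis by (simp add: Fqm_def)
qed

lemma tr_frob: "tr q m ((x::'a) ^ (q ^ i)) = tr q m x ^ (q ^ i)"
  by (simp add: tr_def frob_sum mult.commute flip: power_mult)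

text \<open>The conjugates of \<open>x\<close> repeat with period \<open>n\<close>, so the longer
  trace runs \<open>l\<close> times through the shorter one.\<close>

lemma tr_mult:
  assumes "(x::'a) \<in> Fqm q n"
  shows "tr q (n * l) x = of_nat l * tr q n x"
proof (induction l)
  case (Suc l)
  have per: "x ^ (q ^ (n * j)) = x" for j
  proof (induction j)
    case (Suc j)
    then show ?case using assms by (simp add: Fqm_def power_add power_mult)
  qed simp
  have shift: "x ^ (q ^ (i + n * l)) = x ^ (q ^ i)" for i
    using per[of l] by (simp add: power_add power_mult mult.commute[of "q ^ i"])
  have "tr q (n * Suc l) x = tr q (n * l) x + (\<Sum>i<n. x ^ (q ^ (i + n * l)))"
    using sum.atLeastLessThan_concat[of 0 "n * l" "n * l + n" "\<lambda>i. x ^ (q ^ i)"]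
      sum.shift_bounds_nat_ivl[of "\<lambda>i. x ^ (q ^ i)" 0 "n * l" n]
    by (simp add: tr_def atLeast0LessThan add.commute[of n] add.commute[of _ "n * l"])
  then show ?case unfolding shift Suc tr_def[symmetric] by (simp add: algebra_simps)
qed (simp add: tr_def)

end

section \<open>Fixed points of maps of prime order\<close>

text \<open>Since \<open>l\<close> is prime, the points moved by \<open>f\<close> fall into orbits
  of exactly \<open>l\<close> elements.\<close>

lemma card_cong_card_fixed_points:
  fixes f :: "'b \<Rightarrow> 'b"
  assumes A: "finite A" "f ` A \<subseteq> A" and l: "prime (l::nat)"
    and period: "\<And>x. x \<in> A \<Longrightarrow> (f ^^ l) x = x"
  shows "[card A = card {x\<in>A. f x = x}] (mod l)"
proof -
  define B where "B = {x\<in>A. f x \<noteq> x}"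
  define orb where "orb x = (\<lambda>i. (f ^^ i) x) ` {..<l}" for x
  have l_pos: "l > 0" using l by (rule prime_gt_0_nat)
  have iter_A: "(f ^^ i) x \<in> A" if "x \<in> A" for i x
    using that A(2) by (induction i) auto
  have iter_mod: "(f ^^ (i mod l)) x = (f ^^ i) x" if "x \<in> A" for i x
    by (rule funpow_mod_eq[OF period[OF that]])
  have no_short_period: "(f ^^ k) x \<noteq> x" if x: "x \<in> B" and k: "0 < k" "k < l" for k x
  proof
    assume fp: "(f ^^ k) x = x"
    \<comment> \<open>\<open>k\<close> is invertible modulo \<open>l\<close>, so on \<open>x\<close>
      the map \<open>f\<close> acts as an iterate of \<open>f ^^ k\<close> and would fix
      \<open>x\<close> too.\<close>
    have "\<not> l dvd k" using k by (auto dest: dvd_imp_le)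
    then have "coprime k l" using l by (metis coprime_commute prime_imp_coprime)
    then obtain a where a: "[k * a = 1] (mod l)" using cong_solve_coprime_nat by auto
    have "f x = (f ^^ (1 mod l)) x"
      using iter_mod[of x 1] x by (simp add: B_def)
    also have "1 mod l = (k * a) mod l" using a by (simp add: cong_def)
    also have "(f ^^ ((k * a) mod l)) x = (f ^^ (k * a)) x"
      using iter_mod x by (simp add: B_def)
    also have "\<dots> = x" using funpow_mod_eq[OF fp, of "k * a"] by simp
    finally show False using x by (simp add: B_def)
  qed
  have orb_card: "card (orb x) = l" if x: "x \<in> B" for x
  proof -
    have "(f ^^ i) x \<noteq> (f ^^ j) x" if ij: "i < j" "j < l" for i j
    proof
      assume eq: "(f ^^ i) x = (f ^^ j) x"
      \<comment> \<open>Applying \<open>f ^^ (l - i)\<close> to the supposed equality returns the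
        left side to \<open>x\<close> and exposes the period \<open>j - i\<close>.\<close>
      have "x = (f ^^ (l - i + i)) x" using period[of x] x ij by (simp add: B_def)
      also have "\<dots> = (f ^^ (l - i)) ((f ^^ j) x)" by (simp only: funpow_add o_apply eq)
      also have "\<dots> = (f ^^ (l - i + j)) x" by (simp add: funpow_add)
      also have "\<dots> = (f ^^ ((l - i + j) mod l)) x" using iter_mod x by (simp add: B_def)
      also have "(l - i + j) mod l = j - i"
      proof -
        have "l - i + j = (j - i) + l" using ij by simp
        then have "(l - i + j) mod l = (j - i) mod l" by (metis mod_add_self2)
        also have "\<dots> = j - i" using ij by (intro mod_less) simp
        finally show ?thesis .
      qed
      finally have "(f ^^ (j - i)) x = x" ..
      moreover have "0 < j - i" "j - i < l" using ij by linarith+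
      ultimately show False using no_short_period[OF x] by blast
    qed
    then have "inj_on (\<lambda>i. (f ^^ i) x) {..<l}"
      by (auto simp: inj_on_def) (metis linorder_neqE_nat)
    then show ?thesis by (simp add: orb_def card_image)
  qed
  have orb_B: "orb x \<subseteq> B" if x: "x \<in> B" for x
  proof
    fix y assume "y \<in> orb x"
    then obtain i where i: "i < l" "y = (f ^^ i) x" by (auto simp: orb_def)
    have "f y \<noteq> y"
    proof
      assume fp: "f y = y"
      have "x = (f ^^ (l - i + i)) x" using period[of x] x i by (simp add: B_def)
      also have "\<dots> = (f ^^ (l - i)) y" by (simp only: funpow_add o_apply i(2))
      also have "\<dots> = y" using funpow_mod_eq[where f = f and n = 1 and x = y and m = "l - i"] fp by simp
      finally show False using fp x by (simp add: B_def)
    qed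
    with i iter_A x show "y \<in> B" by (simp add: B_def)
  qed
  have orb_sub: "orb y \<subseteq> orb x" if "x \<in> B" "y \<in> orb x" for x y
  proof
    fix z assume "z \<in> orb y"
    with that obtain i j where "z = (f ^^ (j + i)) x" by (auto simp: orb_def funpow_add)
    then have "z = (f ^^ ((j + i) mod l)) x" using iter_mod that by (simp add: B_def)
    then show "z \<in> orb x" using l_pos by (auto simp: orb_def)
  qed
  have orb_sym: "x \<in> orb y" if x: "x \<in> B" and y: "y \<in> orb x" for x y
  proof -
    obtain i where i: "i < l" "y = (f ^^ i) x" using y by (auto simp: orb_def)
    have "x = (f ^^ (l - i + i)) x" using period[of x] x i by (simp add: B_def)
    also have "\<dots> = (f ^^ (l - i)) y" by (simp only: funpow_add o_apply i(2))
    also have "\<dots> = (f ^^ ((l - i) mod l)) y"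
      using iter_mod[of y] iter_A[of x i] i x by (simp add: B_def)
    finally show ?thesis using l_pos by (auto simp: orb_def)
  qed
  have orb_eq: "orb y = orb x" if "x \<in> B" "y \<in> orb x" for x y
    using orb_sub[OF that] orb_sub[of y x] orb_sym[OF that] orb_B that by blast
  have self: "x \<in> orb x" for x using l_pos image_eqI[of x "\<lambda>i. (f ^^ i) x" 0 "{..<l}"] by (simp add: orb_def)
  have union: "\<Union> (orb ` B) = B" using orb_B self by blast
  have "finite B" using A by (simp add: B_def)
  \<comment> \<open>Orbits that meet coincide, so they partition \<open>B\<close> into blocks of
    size \<open>l\<close>.\<close>
  have "l dvd card (\<Union> (orb ` B))"
  proof (rule dvd_partition)
    show "\<forall>c1\<in>orb ` B. \<forall>c2\<in>orb ` B. c1 \<noteq> c2 \<longrightarrow> c1 \<inter> c2 = {}"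
      using orb_eq by blast
  qed (use orb_card \<open>finite B\<close> union in auto)
  then have "l dvd card B" by (simp only: union)
  moreover have "card ({x\<in>A. f x = x} \<union> B) = card {x\<in>A. f x = x} + card B"
    using A(1) by (intro card_Un_disjoint) (auto simp: B_def)
  moreover have "{x\<in>A. f x = x} \<union> B = A" by (auto simp: B_def)
  ultimately show ?thesis by (simp add: cong_def mod_add_right_eq[symmetric])
qed

section \<open>Forms given by linearized polynomials\<close>

text \<open>\<open>lam\<close> is a definite description; for \<open>q > 1\<close> the factor
  multiplying the sign is nonzero, so at most one sign fits.\<close>

lemma lam_eqI:
  assumes "q > 1" "s \<in> {- 1, 0, 1}"
    and "real (card {x \<in> Fqm q m. Qform q c d m x = 0}) =
       real q ^ (m - 1) + real_of_int s * (real q - 1) *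
         real q powr ((real m + real (wdim q c d m)) / 2 - 1)"
  shows "lam q c d m = s"
  unfolding lam_def
proof (rule the_equality)
  fix t :: int
  assume "t \<in> {- 1, 0, 1} \<and> real (card {x \<in> Fqm q m. Qform q c d m x = 0}) =
     real q ^ (m - 1) + real_of_int t * (real q - 1) *
       real q powr ((real m + real (wdim q c d m)) / 2 - 1)"
  with assms have "real_of_int t * ((real q - 1) * real q powr ((real m + real (wdim q c d m)) / 2 - 1)) =
      real_of_int s * ((real q - 1) * real q powr ((real m + real (wdim q c d m)) / 2 - 1))"
    by simp
  with assms(1) show "t = s" by simp
qed (use assms in blast)

locale linearized_form = field_of_odd_order p e q M type_token
  for p e q M and type_token :: "'a::{field,finite} itself" +
  fixes c :: "nat \<Rightarrow> 'a" and d m :: nat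
  assumes coeff: "c i \<in> Fqm q 1" and m_pos: "m \<ge> 1" and m_dvd: "m dvd M"
begin

text \<open>Half the polarization of \<open>Qform\<close>, so that its diagonal is the form
  itself.\<close>

definition polar :: "'a \<Rightarrow> 'a \<Rightarrow> 'a" where
  "polar x y = (tr q m (x * linpoly q c d y) + tr q m (y * linpoly q c d x)) / 2"

lemma linpoly_add: "linpoly q c d (x + y) = linpoly q c d x + linpoly q c d y"
  by (simp add: linpoly_def frob_add sum.distrib distrib_left)

lemma linpoly_scale: "t \<in> Fqm q 1 \<Longrightarrow> linpoly q c d (t * x) = t * linpoly q c d x"
  by (simp add: linpoly_def power_mult_distrib Fq_frob sum_distrib_left mult.left_commute)

lemma polar_self: "polar x x = Qform q c d m x"
proof -
  have "polar x x = 2 * Qform q c d m x / 2" by (simp only: polar_def Qform_def mult_2)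
  then show ?thesis using two_nonzero by simp
qed

lemma Qform_add: "Qform q c d m (x + y) - Qform q c d m x - Qform q c d m y = 2 * polar x y"
proof -
  have "2 * polar x y = tr q m (x * linpoly q c d y) + tr q m (y * linpoly q c d x)"
    using two_nonzero by (simp add: polar_def)
  then show ?thesis
    by (simp add: Qform_def linpoly_add distrib_left distrib_right tr_add)
qed

sublocale scalars: odd_finite_subfield "Fqm q 1 :: 'a set"
proof -
  interpret finite_subfield "Fqm q 1 :: 'a set" by (rule finite_subfield_Fqm)
  show "odd_finite_subfield (Fqm q 1 :: 'a set)" by unfold_locales (rule two_nonzero)
qed

sublocale form: quadratic_space "Fqm q 1 :: 'a set" polar
proof unfold_locales
  show "polar (x + y) z = polar x z + polar y z" for x y z
    by (simp add: polar_def linpoly_add distrib_left distrib_right tr_add flip: add_divide_distrib)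
  show "polar (t * x) z = t * polar x z" if "t \<in> Fqm q 1" for t x z
    using that tr_scale[of t m "x * linpoly q c d z"] tr_scale[of t m "z * linpoly q c d x"]
    by (simp add: polar_def linpoly_scale mult.assoc mult.left_commute[of z] distrib_left)
  show "polar x y = polar y x" for x y
    by (simp add: polar_def add.commute)
qed

lemma subspace_Fqm: "scalars.subspace (Fqm q m)"
  using Fqm_mono[of m] finite_subfield.mult_mem[OF finite_subfield_Fqm]
    finite_subfield.add_mem[OF finite_subfield_Fqm] finite_subfield.zero_mem[OF finite_subfield_Fqm]
  unfolding scalars.subspace_def by blast

lemma linpoly_mem:
  assumes "x \<in> Fqm q m"
  shows "linpoly q c d x \<in> Fqm q m"
proof -
  interpret K: finite_subfield "Fqm q m :: 'a set" by (rule finite_subfield_Fqm)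
  show ?thesis unfolding linpoly_def
    using Fqm_mono[of m] coeff assms by (blast intro: K.sum_mem K.mult_mem K.power_mem)
qed

lemma polar_mem:
  assumes "x \<in> Fqm q m" "y \<in> Fqm q m"
  shows "polar x y \<in> Fqm q 1"
proof -
  interpret K: finite_subfield "Fqm q m :: 'a set" by (rule finite_subfield_Fqm)
  have "2 \<in> (Fqm q 1 :: 'a set)"
    using scalars.add_mem[OF scalars.one_mem scalars.one_mem] by simp
  then show ?thesis unfolding polar_def
    using assms by (intro scalars.divide_mem scalars.add_mem tr_mem K.mult_mem linpoly_mem)
qed

lemma rad_eq: "form.rad (Fqm q m) = radical q c d m"
  using two_nonzero by (simp add: form.rad_def radical_def Qform_add)

lemma card_radical: "card (radical q c d m) = q ^ wdim q c d m"
  using scalars.card_subspace[OF refl _ form.subspace_rad[OF subspace_Fqm]] card_Fqm[of 1]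
  by (simp add: rad_eq wdim_def)

lemma reps_eq: "form.reps (Fqm q m) a = card {x \<in> Fqm q m. Qform q c d m x = a}"
  by (simp add: form.reps_def polar_self)

text \<open>\<open>lam\<close> is defined through the zeros alone; the classification carries its
  sign to every other level. Odd rank is excluded: it has exactly \<open>q ^ (m - 1)\<close> zeros,
  which forces \<open>lam\<close> to be 0.\<close>

lemma level_set_counts:
  assumes "lam q c d m \<noteq> 0"
  obtains k where "m = 2 * k + wdim q c d m"
    and "\<And>a. a \<in> Fqm q 1 \<Longrightarrow>
      int q * int (card {x \<in> Fqm q m. Qform q c d m x = a}) =
        int q ^ m + lam q c d m * int q ^ (k + wdim q c d m) * (int q * of_bool (a = 0) - 1)"
proof -
  let ?w = "wdim q c d m" and ?N = "\<lambda>a. card {x \<in> Fqm q m. Qform q c d m x = a}"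
  have card_F: "card (Fqm q 1 :: 'a set) = q" using card_Fqm[of 1] by simp
  have card_V: "card (Fqm q m :: 'a set) = q ^ m" using card_Fqm m_pos m_dvd by simp
  note params = card_F card_V rad_eq card_radical reps_eq
  have real_eq: "real (?N 0) = x" if "real q * real (?N 0) = real q * x" for x
    using that q_gt_1 by simp
  have q_m: "real q ^ m = real q * real q ^ (m - 1)"
    using m_pos by (simp flip: power_Suc)
  obtain k s where s: "s \<in> {- 1, 1}"
    and "form.even_rank_counts (Fqm q m) k s \<or> form.odd_rank_counts (Fqm q m) k s"
    using form.reps_classification[OF _ subspace_Fqm polar_mem] by auto
  then show ?thesis
  proof (elim disjE)
    assume "form.even_rank_counts (Fqm q m) k s"
    then have pow: "q ^ m = q ^ (2 * k + ?w)"
      and N: "\<And>a. a \<in> Fqm q 1 \<Longrightarrow> int q * int (?N a) =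
          int q ^ m + s * int q ^ (k + ?w) * (int q * of_bool (a = 0) - 1)"
      unfolding form.even_rank_counts_def params by (simp_all add: power_add mult.assoc)
    \<comment> \<open>Comparing cardinalities of the whole space identifies the rank.\<close>
    have m: "m = 2 * k + ?w" using power_inject_exp[OF q_gt_1] pow by blast
    have "lam q c d m = s"
    proof (rule lam_eqI[OF q_gt_1])
      have "real m = real (2 * k + ?w)" by (rule arg_cong[OF m])
      \<comment> \<open>Half of \<open>m + ?w\<close> is the natural number \<open>k + ?w\<close>;
        multiplying by \<open>q\<close> then absorbs the \<open>- 1\<close> in the exponent.\<close>
      then have "(real m + real ?w) / 2 - 1 = real (k + ?w) - 1" by simp
      then have powr: "real q * real q powr ((real m + real ?w) / 2 - 1) = real q ^ (k + ?w)"
        using q_gt_1 by (simp add: powr_diff powr_realpow del: of_nat_add)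
      have "real_of_int (int q * int (?N 0)) = real_of_int (int q ^ m + s * int q ^ (k + ?w) * (int q - 1))"
        using N[OF scalars.zero_mem] by simp
      then have "real q * real (?N 0) = real q ^ m + real_of_int s * real q ^ (k + ?w) * (real q - 1)"
        by simp
      then show "real (?N 0) = real q ^ (m - 1) +
          real_of_int s * (real q - 1) * real q powr ((real m + real ?w) / 2 - 1)"
        unfolding q_m powr[symmetric] by (intro real_eq) (simp add: algebra_simps)
    qed (use s in auto)
    with m N that show ?thesis by blast
  next
    assume odd: "form.odd_rank_counts (Fqm q m) k s"
    then have pow: "q ^ m = q ^ (2 * k + 1 + ?w)"
      unfolding form.odd_rank_counts_def params by (simp add: power_add mult.assoc)
    have "int (?N 0) = int q ^ (2 * k) * int (q ^ ?w)"
      using odd[unfolded form.odd_rank_counts_def params, THEN conjunct2, rule_format, OF scalars.zero_mem]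
      by (simp only: scalars.quad_char_zero mult_zero_right add_0_right)
    then have "int (?N 0) = int (q ^ (2 * k + ?w))" by (simp add: power_add)
    then have N: "?N 0 = q ^ (2 * k + ?w)" by (simp only: of_nat_eq_iff)
    have "m = 2 * k + 1 + ?w" using power_inject_exp[OF q_gt_1] pow by blast
    then have "m - 1 = 2 * k + ?w" by simp
    then have "lam q c d m = 0" by (intro lam_eqI[OF q_gt_1]) (simp_all add: N)
    with assms show ?thesis by simp
  qed
qed

text \<open>The coefficients are scalars, hence fixed by Frobenius. The form therefore commutes with
  it, and level sets at scalar values are preserved.\<close>

lemma linpoly_frob: "linpoly q c d (x ^ (q ^ i)) = linpoly q c d x ^ (q ^ i)"
  by (simp add: linpoly_def frob_sum power_mult_distrib Fq_frob[OF coeff] mult.commute flip: power_mult)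

lemma Qform_frob: "Qform q c d m (x ^ (q ^ i)) = Qform q c d m x ^ (q ^ i)"
  by (simp add: Qform_def linpoly_frob tr_frob flip: power_mult_distrib)

end

theorem mainTheorem3:
  fixes p e q n l d :: nat and c :: "nat \<Rightarrow> 'a::{field,finite}"
  assumes "prime p" and "odd p" and "e \<ge> 1" and "q = p ^ e"
    and "CARD('a) = q ^ (n * l)"
    and "\<And>i. c i \<in> Fqm q 1"
    and "n \<ge> 1" and "prime l" and "coprime l (2 * p)"
    and "lam q c d n \<noteq> 0" and "lam q c d (n * l) \<noteq> 0"
  shows "[lam q c d n = lam q c d (n * l) * int q ^
            nat ((int n * (int l - 1) + int (wdim q c d (n * l)) - int (wdim q c d n)) div 2)]
         (mod int l)"
proof -
  have l_gt_2: "l > 2"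
    using assms(8,9) prime_ge_2_nat[of l] by (cases "l = 2") auto
  \<comment> \<open>With \<open>l\<close> different from \<open>p\<close>, \<open>l\<close> is a
    nonzero scalar and \<open>q\<close> is invertible modulo \<open>l\<close>.\<close>
  have l_p: "\<not> p dvd l" "coprime l p"
    using assms(1,8,9) primes_dvd_imp_eq[of p l] by auto
  interpret field_of_odd_order p e q "n * l" "TYPE('a)"
    using assms by unfold_locales auto
  interpret small: linearized_form p e q "n * l" "TYPE('a)" c d n
    using assms by unfold_locales auto
  interpret big: linearized_form p e q "n * l" "TYPE('a)" c d "n * l"
    using assms l_gt_2 by unfold_locales auto
  let ?w = "wdim q c d n" and ?w' = "wdim q c d (n * l)"
  have l_nz: "of_nat l \<noteq> (0::'a)" using l_p of_nat_eq_0 by simp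
  have l_mem: "of_nat l \<in> (Fqm q 1 :: 'a set)"
    using small.scalars.sum_mem[of "{..<l}" "\<lambda>_. 1"] small.scalars.one_mem by simp

  \<comment> \<open>Level \<open>l\<close> is chosen because on the small field the long form is
    \<open>l\<close> times the short one, which puts the fixed points at level 1.\<close>
  define A :: "'a set" where "A = {x \<in> Fqm q (n * l). Qform q c d (n * l) x = of_nat l}"
  define frob :: "'a \<Rightarrow> 'a" where "frob x = x ^ (q ^ n)" for x
  have frob_iter: "(frob ^^ j) x = x ^ (q ^ (n * j))" for j x
    by (induction j) (simp_all add: frob_def power_add mult.commute flip: power_mult)
  have fixed: "{x\<in>A. frob x = x} = {x \<in> Fqm q n. Qform q c d n x = 1}"
  proof -
    have "x \<in> Fqm q (n * l)" if "x \<in> Fqm q n" for x :: 'a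
    proof -
      have "frob x = x" using that by (simp add: frob_def Fqm_def)
      then have "(frob ^^ l) x = x" by (induction l) simp_all
      then show ?thesis by (simp add: frob_iter Fqm_def)
    qed
    moreover have "Qform q c d (n * l) x = of_nat l * Qform q c d n x" if "x \<in> Fqm q n" for x
      unfolding Qform_def using that small.linpoly_mem
      by (intro tr_mult finite_subfield.mult_mem[OF finite_subfield_Fqm])
    ultimately show ?thesis
      using l_nz by (auto simp: A_def frob_def) (auto simp: Fqm_def)
  qed
  have "[card A = card {x\<in>A. frob x = x}] (mod l)"
  proof (rule card_cong_card_fixed_points[OF _ _ assms(8)])
    show "frob ` A \<subseteq> A"
      using finite_subfield.power_mem[OF finite_subfield_Fqm] Fq_frob[OF l_mem]
      by (auto simp: A_def frob_def big.Qform_frob)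
  qed (auto simp: frob_iter A_def Fqm_def)
  then have N_cong: "[int (card A) = int (card {x \<in> Fqm q n. Qform q c d n x = 1})] (mod int l)"
    by (simp only: fixed cong_int_iff)

  obtain k where k: "n = 2 * k + ?w"
    and "\<And>a. a \<in> Fqm q 1 \<Longrightarrow> int q * int (card {x \<in> Fqm q n. Qform q c d n x = a}) =
        int q ^ n + lam q c d n * int q ^ (k + ?w) * (int q * of_bool (a = 0) - 1)"
    using small.level_set_counts[OF assms(10)] by blast
  from this(2)[OF small.scalars.one_mem] have N: "int q * int (card {x \<in> Fqm q n. Qform q c d n x = 1}) =
      int q ^ n - lam q c d n * int q ^ (k + ?w)"
    by simp
  obtain k' where k': "n * l = 2 * k' + ?w'"
    and "\<And>a. a \<in> Fqm q 1 \<Longrightarrow> int q * int (card {x \<in> Fqm q (n * l). Qform q c d (n * l) x = a}) =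
        int q ^ (n * l) + lam q c d (n * l) * int q ^ (k' + ?w') * (int q * of_bool (a = 0) - 1)"
    using big.level_set_counts[OF assms(11)] by blast
  from this(2)[OF l_mem] have N': "int q * int (card A) =
      int q ^ (n * l) - lam q c d (n * l) * int q ^ (k' + ?w')"
    using l_nz by (simp add: A_def)

  \<comment> \<open>Reduction modulo \<open>l\<close>\<close>
  have coprime: "coprime (int q) (int l)"
    using l_p by (simp add: assms(4) coprime_commute)
  have fermat: "[int q ^ (n * l) = int q ^ n] (mod int l)"
  proof -
    have "[(q ^ n) ^ (l - 1) = 1] (mod l)"
    proof (rule fermat_theorem[OF assms(8)])
      have "coprime l (q ^ n)" using l_p by (simp add: assms(4))
      then show "\<not> l dvd q ^ n" using assms(8) by (metis coprime_absorb_left not_prime_unit)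
    qed
    then have "[q ^ n * (q ^ n) ^ (l - 1) = q ^ n * 1] (mod l)" by (intro cong_mult cong_refl)
    moreover have "q ^ n * (q ^ n) ^ (l - 1) = q ^ (n * l)"
      using l_gt_2 by (simp add: power_mult flip: power_Suc)
    ultimately have "[q ^ (n * l) = q ^ n] (mod l)" by simp
    then show ?thesis by (simp flip: cong_int_iff)
  qed
  \<comment> \<open>Each side equals its sign term, free of any factor \<open>q - 1\<close>.\<close>
  have "[int q ^ n - int q * int (card {x \<in> Fqm q n. Qform q c d n x = 1}) =
      int q ^ (n * l) - int q * int (card A)] (mod int l)"
    using fermat N_cong by (intro cong_diff cong_mult cong_refl) (simp_all add: cong_sym_eq)
  then have key: "[lam q c d n * int q ^ (k + ?w) = lam q c d (n * l) * int q ^ (k' + ?w')] (mod int l)"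
    unfolding N N' by simp

  define E where "E = k' + ?w' - (k + ?w)"
  \<comment> \<open>Together with \<open>k + ?w \<le> n\<close> and
    \<open>n * l \<le> 2 * (k' + ?w')\<close>, this makes the natural subtraction in
    \<open>E\<close> exact.\<close>
  have "n * 2 \<le> n * l" using l_gt_2 by (intro mult_le_mono) auto
  with k k' have E: "k' + ?w' = E + (k + ?w)" unfolding E_def by linarith
  \<comment> \<open>Substituting for \<open>n\<close> and \<open>n * l\<close> shows that the
    numerator is even, so \<open>div 2\<close> loses nothing.\<close>
  have "int n * (int l - 1) + int ?w' - int ?w = 2 * int E"
  proof -
    have "int n * (int l - 1) = int (n * l) - int n" by (simp add: algebra_simps)
    also have "\<dots> = int (2 * k' + ?w') - int (2 * k + ?w)" using k k' by metis
    finally show ?thesis using E by linarith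
  qed
  then have "nat ((int n * (int l - 1) + int ?w' - int ?w) div 2) = E" by simp
  moreover have "[lam q c d n = lam q c d (n * l) * int q ^ E] (mod int l)"
  proof -
    have "[lam q c d n * int q ^ (k + ?w) = lam q c d (n * l) * int q ^ E * int q ^ (k + ?w)] (mod int l)"
      using key by (simp only: E power_add mult.assoc)
    then show ?thesis using coprime by (subst (asm) cong_mult_rcancel) simp_all
  qed
  ultimately show ?thesis by simp
qed

end
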